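(* For $n\ge 1$ and integers $i,j$, let $\underline{b}_{n,i,j}$ be the number of $\pi\in\mathfrak{B}_n$ with $\operatorname{des}_B(\pi)=i$ and $\operatorname{ides}_B(\pi)=j$ (so $\underline{b}_{n,i,j}=0$ if $i<0$ or $j<0$). Then $\underline{b}_{1,0,0}=\underline{b}_{1,1,1}=1$, $\underline{b}_{1,0,1}=\underline{b}_{1,1,0}=0$, and for all $n\ge 2$ and $0\le i,j\le n$, \[ \begin{aligned} n\,\underline{b}_{n,i,j}={}&(n+i+j+2ij)\,\underline{b}_{n-1,i,j}+\big((2n-1)i-(2i+1)(j-1)\big)\,\underline{b}_{n-1,i,j-1}\\ &+\big((2n-1)j-(2j+1)(i-1)\big)\,\underline{b}_{n-1,i-1,j}\\ &+\big((2n^2-n)+2(i-1)(j-1)+(1-2n)(i+j-2)\big)\,\underline{b}_{n-1,i-1,j-1}. \end{aligned} \]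
   Context: For a positive integer $n$, $\mathfrak{B}_n$ is the set of signed permutations of length $n$: words $\pi=\pi_1\cdots\pi_n$ with $\pi_i\in\{\pm1,\dots,\pm n\}$ such that $|\pi_1|,\dots,|\pi_n|$ is a permutation of $[n]$. Set $\pi_0=0$. The inverse $\pi^{-1}\in\mathfrak{B}_n$ is defined by $\pi^{-1}_{|\pi_i|}=\operatorname{sgn}(\pi_i)\,i$. The $r$-order on $\mathbb{Z}$ is the total order $-1<_r-2<_r-3<_r\cdots<_r0<_r1<_r2<_r\cdots$ (all negatives below $0$ and the positives, with $-a<_r-b$ iff $a<b$; nonnegatives in natural order). Define $\operatorname{des}_B(\pi)=|\{i\in\{0,\dots,n-1\}:\pi_i>_r\pi_{i+1}\}|$ and $\operatorname{ides}_B(\pi)=\operatorname{des}_B(\pi^{-1})$. *)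

theory Defs
  imports Complex_Main
begin

text \<open>
  A word \<open>\<pi>\<^sub>1 \<dots> \<pi>\<^sub>n\<close> is the list of its letters. \<open>letter w i\<close> is the letter \<open>\<pi>\<^sub>i\<close>, with positions
  counted from 1 and the convention \<open>\<pi>\<^sub>0 = 0\<close>; it is meaningful for \<open>i \<le> length w\<close> only.
\<close>

definition letter :: "int list \<Rightarrow> nat \<Rightarrow> int" where
  "letter w i = (0 # w) ! i"

definition signed_perms :: "nat \<Rightarrow> int list set" where
  "signed_perms n =
     {w. length w = n \<and> bij_betw (\<lambda>i. nat \<bar>letter w i\<bar>) {1..n} {1..n}}"

definition sp_inv :: "int list \<Rightarrow> int list" where
  "sp_inv w = (THE v. v \<in> signed_perms (length w) \<and>
     (\<forall>i\<in>{1..length w}. letter v (nat \<bar>letter w i\<bar>) = sgn (letter w i) * int i))"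

text \<open>The order \<open>-1 < -2 < -3 < \<dots> < 0 < 1 < 2 < \<dots>\<close>: reversed among the negative integers.\<close>

definition r_less :: "int \<Rightarrow> int \<Rightarrow> bool"  (infix \<open><r\<close> 50) where
  "a <r b \<longleftrightarrow> (if a < 0 \<and> b < 0 then b < a else a < b)"

definition des_B :: "int list \<Rightarrow> nat" where
  "des_B w = card {i \<in> {0..<length w}. letter w (i + 1) <r letter w i}"

definition ides_B :: "int list \<Rightarrow> nat" where
  "ides_B w = des_B (sp_inv w)"

definition b_num :: "nat \<Rightarrow> int \<Rightarrow> int \<Rightarrow> nat" where
  "b_num n i j =
     card {w \<in> signed_perms n. int (des_B w) = i \<and> int (ides_B w) = j}"

text \<open>The inverse is well defined, so the description in \<open>sp_inv_def\<close> denotes it.\<close>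

lemma sp_inv_ex1:
  assumes w: "w \<in> signed_perms n"
  shows "\<exists>!v. v \<in> signed_perms n \<and>
    (\<forall>i\<in>{1..n}. letter v (nat \<bar>letter w i\<bar>) = sgn (letter w i) * int i)"
proof -
  define f where "f = (\<lambda>i. nat \<bar>letter w i\<bar>)"
  have bij: "bij_betw f {1..n} {1..n}"
    using w by (simp add: signed_perms_def f_def)
  define g where "g = inv_into {1..n} f"
  have gbij: "bij_betw g {1..n} {1..n}"
    unfolding g_def using bij by (rule bij_betw_inv_into)
  have gf: "g (f i) = i" if "i \<in> {1..n}" for i
    unfolding g_def using bij that by (rule bij_betw_inv_into_left)
  have fg: "f (g k) = k" if "k \<in> {1..n}" for k
    unfolding g_def using bij that by (rule bij_betw_inv_into_right)
  have gin: "g k \<in> {1..n}" if "k \<in> {1..n}" for k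
    using gbij that by (auto simp: bij_betw_def)
  have fin: "f k \<in> {1..n}" if "k \<in> {1..n}" for k
    using bij that by (auto simp: bij_betw_def)
  define v where "v = map (\<lambda>k. sgn (letter w (g k)) * int (g k)) [1..<Suc n]"
  have len: "length v = n" by (simp add: v_def)
  have v: "letter v k = sgn (letter w (g k)) * int (g k)" if "k \<in> {1..n}" for k
  proof -
    have "k = Suc (k - 1)" and "k - 1 < n" using that by auto
    then obtain m where "k = Suc m" and "m < n" by blast
    then show ?thesis by (simp add: letter_def v_def del: upt_Suc)
  qed
  have nz: "letter w i \<noteq> 0" if "i \<in> {1..n}" for i
    using fin[OF that] by (auto simp: f_def)
  have abs_v: "nat \<bar>letter v k\<bar> = g k" if "k \<in> {1..n}" for k
    using v[OF that] nz[OF gin[OF that]] by (auto simp: sgn_if)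
  have "bij_betw (\<lambda>k. nat \<bar>letter v k\<bar>) {1..n} {1..n}"
    using gbij by (subst bij_betw_cong[OF abs_v])
  then have vin: "v \<in> signed_perms n" using len by (simp add: signed_perms_def)
  have veq: "letter v (f i) = sgn (letter w i) * int i" if "i \<in> {1..n}" for i
    using v[OF fin[OF that]] gf[OF that] by simp
  show ?thesis
  proof (rule ex1I[of _ v])
    show "v \<in> signed_perms n \<and>
      (\<forall>i\<in>{1..n}. letter v (nat \<bar>letter w i\<bar>) = sgn (letter w i) * int i)"
      using vin veq by (simp add: f_def)
  next
    fix u
    assume u: "u \<in> signed_perms n \<and>
      (\<forall>i\<in>{1..n}. letter u (nat \<bar>letter w i\<bar>) = sgn (letter w i) * int i)"
    show "u = v"
    proof (rule nth_equalityI)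
      show "length u = length v" using u len by (simp add: signed_perms_def)
    next
      fix m assume "m < length u"
      then have k: "Suc m \<in> {1..n}" using u by (simp add: signed_perms_def)
      have "letter u (f (g (Suc m))) = letter v (f (g (Suc m)))"
        using u veq[OF gin[OF k]] gin[OF k] by (simp add: f_def)
      then show "u ! m = v ! m" using fg[OF k] by (simp add: letter_def)
    qed
  qed
qed

lemma sp_inv_in_signed_perms:
  assumes "w \<in> signed_perms n"
  shows "sp_inv w \<in> signed_perms n"
  using theI'[OF sp_inv_ex1[OF assms]] assms by (simp add: sp_inv_def signed_perms_def)

lemma letter_sp_inv:
  assumes "w \<in> signed_perms n" and "i \<in> {1..n}"
  shows "letter (sp_inv w) (nat \<bar>letter w i\<bar>) = sgn (letter w i) * int i"
  using theI'[OF sp_inv_ex1[OF assms(1)]] assms by (simp add: sp_inv_def signed_perms_def)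

end

theory Submission
  imports Defs
begin

text \<open>
  Inserting a letter of either sign, at any of \<open>n\<close> positions and with any of \<open>n\<close> absolute values, into a
  signed permutation of length \<open>n - 1\<close> gives every signed permutation of length \<open>n\<close> exactly \<open>n\<close> times, once
  for each of its letters. An insertion raises each of \<open>des_B\<close> and \<open>ides_B\<close> by 0 or 1. Among the
  \<open>2n\<^sup>2\<close> insertions into a fixed \<open>w\<close> with statistics \<open>(a, b)\<close>, telescoping sums show that \<open>n(2a + 1)\<close>
  keep \<open>des_B\<close> and \<open>n(2b + 1)\<close> keep \<open>ides_B\<close>, and a summation by parts shows that
  \<open>n + a + b + 2ab\<close> keep both. These counts do not depend on \<open>w\<close> otherwise, and they give the four
  coefficients of the recurrence.
\<close>

section \<open>Insertion of a signed letter\<close>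

definition lift_above :: "nat \<Rightarrow> int \<Rightarrow> int" where
  "lift_above q a = (if \<bar>a\<bar> \<le> int q then a else a + sgn a)"

text \<open>Gap \<open>p\<close> and value \<open>q\<close> are both counted from 0: the new letter
  has position \<open>p + 1\<close>, absolute value \<open>q + 1\<close> and sign \<open>e\<close>.
  Position and value are thus treated alike, and inversion merely exchanges \<open>p\<close> and
  \<open>q\<close>.\<close>

definition insert_letter :: "nat \<Rightarrow> nat \<Rightarrow> int \<Rightarrow> int list \<Rightarrow> int list" where
  "insert_letter p q e w =
     take p (map (lift_above q) w) @ (e * (int q + 1)) # drop p (map (lift_above q) w)"

text \<open>The guard gives 0 at the gap behind the last letter, so that sums may run over all
  \<open>length w + 1\<close> gaps.\<close>

definition descent :: "int list \<Rightarrow> nat \<Rightarrow> int" where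
  "descent w p = of_bool (p < length w \<and> letter w (p + 1) <r letter w p)"

text \<open>
  \<open>below\<close> vanishes at \<open>length w + 1\<close>, as if a letter \<open>+\<infinity>\<close> followed \<open>w\<close>; this makes \<open>keeps_des\<close>, the
  0/1 indicator that inserting at gap \<open>p\<close> preserves \<open>des_B\<close>, correct at the last gap as well.
\<close>

definition below :: "nat \<Rightarrow> int \<Rightarrow> int list \<Rightarrow> nat \<Rightarrow> int" where
  "below q e w p = of_bool (p \<le> length w \<and> lift_above q (letter w p) <r e * (int q + 1))"

definition keeps_des :: "int list \<Rightarrow> nat \<Rightarrow> nat \<Rightarrow> int \<Rightarrow> int" where
  "keeps_des w p q e = descent w p + below q e w p - below q e w (p + 1)"

section \<open>Making room for a new absolute value\<close>

lemma lift_above_r_less_iff: "lift_above q a <r lift_above q b \<longleftrightarrow> a <r b"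
  by (auto simp: lift_above_def r_less_def sgn_if)

lemma inj_lift_above: "inj (lift_above q)"
  by (auto simp: inj_def lift_above_def sgn_if split: if_splits)

lemma lift_above_eq_0_iff [simp]: "lift_above q a = 0 \<longleftrightarrow> a = 0"
  by (auto simp: lift_above_def sgn_if)

lemma abs_lift_above: "\<bar>lift_above q a\<bar> = (if \<bar>a\<bar> \<le> int q then \<bar>a\<bar> else \<bar>a\<bar> + 1)"
  by (auto simp: lift_above_def sgn_if)

lemma sgn_lift_above [simp]: "sgn (lift_above q a) = sgn a"
  by (auto simp: lift_above_def sgn_if)

text \<open>On absolute values, \<open>lift_above q\<close> is an injection that carries
  \<open>{1..m}\<close> onto \<open>{1..m + 1}\<close> without \<open>q + 1\<close>, and an
  injection can be cancelled from an equation between images.\<close>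

lemma abs_lift_above_image:
  assumes "q \<le> m"
  shows "(\<lambda>a. \<bar>lift_above q a\<bar>) ` A = {1..int m + 1} - {int q + 1} \<longleftrightarrow> abs ` A = {1..int m}"
proof -
  define f where "f = (\<lambda>a. if a \<le> int q then a else a + 1)"
  have inj: "inj f" by (auto simp: inj_def f_def split: if_splits)
  have f: "f ` {1..int m} = {1..int m + 1} - {int q + 1}"
  proof (intro equalityI subsetI)
    fix x assume x: "x \<in> {1..int m + 1} - {int q + 1}"
    then have "x = f (if x \<le> int q then x else x - 1)" by (auto simp: f_def)
    moreover have "(if x \<le> int q then x else x - 1) \<in> {1..int m}" using x assms by auto
    ultimately show "x \<in> f ` {1..int m}" by blast
  qed (use assms in \<open>auto simp: f_def\<close>)
  have "(\<lambda>a. \<bar>lift_above q a\<bar>) ` A = f ` abs ` A"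
    by (auto simp: image_image f_def abs_lift_above)
  then show ?thesis using f inj by (metis inj_image_eq_iff)
qed

section \<open>Insertion and deletion in signed permutations\<close>

lemma letter_0 [simp]: "letter w 0 = 0"
  by (simp add: letter_def)

lemma image_letter: "letter w ` {1..length w} = set w"
proof -
  have "letter w ` {1..length w} = letter w ` Suc ` {..<length w}"
    by (simp add: image_Suc_lessThan)
  also have "\<dots> = set w" by (auto simp: image_image letter_def set_conv_nth)
  finally show ?thesis .
qed

text \<open>A map of a finite set onto itself is a bijection, so the set of absolute values decides
  membership. Positions drop out, which suits insertion.\<close>

lemma signed_perms_iff:
  "w \<in> signed_perms n \<longleftrightarrow> length w = n \<and> abs ` set w = {1..int n}"
proof -
  have 1: "nat ` abs ` set w = {1..n} \<longleftrightarrow> abs ` set w = {1..int n}"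
  proof
    assume "nat ` abs ` set w = {1..n}"
    then have "int ` nat ` abs ` set w = int ` {1..n}" by simp
    then show "abs ` set w = {1..int n}" by (simp add: image_image image_int_atLeastAtMost)
  next
    assume "abs ` set w = {1..int n}"
    then have "abs ` set w = int ` {1..n}" by (simp add: image_int_atLeastAtMost)
    then show "nat ` abs ` set w = {1..n}" by (simp add: image_image)
  qed
  have 2: "bij_betw f {1..n} {1..n} \<longleftrightarrow> f ` {1..n} = {1..n}" for f :: "nat \<Rightarrow> nat"
    by (auto simp: bij_betw_def intro: eq_card_imp_inj_on)
  have 3: "(\<lambda>i. nat \<bar>letter w i\<bar>) ` {1..n} = nat ` abs ` set w" if "length w = n"
    using image_letter[of w] that by (simp add: image_image flip: image_letter)
  show ?thesis
  proof (cases "length w = n")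
    case True
    then show ?thesis by (simp only: signed_perms_def mem_Collect_eq 2 3[OF True] 1)
  qed (simp add: signed_perms_def)
qed

lemma length_insert_letter [simp]: "length (insert_letter p q e w) = length w + 1"
  by (simp add: insert_letter_def)

lemma letter_insert_letter:
  assumes "p \<le> length w" "i \<le> length w + 1"
  shows "letter (insert_letter p q e w) i =
    (if i \<le> p then lift_above q (letter w i)
     else if i = p + 1 then e * (int q + 1) else lift_above q (letter w (i - 1)))"
proof (cases i)
  case 0
  then show ?thesis by simp
next
  case (Suc k)
  show ?thesis
  proof (cases "k \<le> p")
    case True
    then show ?thesis using assms Suc
      by (auto simp: letter_def insert_letter_def nth_append)
  next
    case False
    then have "k - p = Suc (k - p - 1)" by simp
    with False show ?thesis using assms Suc
      by (auto simp: letter_def insert_letter_def nth_append nth_Cons' min_def)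
  qed
qed

text \<open>\<open>lift_above q\<close> never produces the absolute value \<open>q + 1\<close>, so
  this value can be removed from both sides of the equation between sets of absolute values.\<close>

lemma insert_letter_in_signed_perms_iff:
  assumes "q \<le> m" "\<bar>e\<bar> = 1"
  shows "insert_letter p q e w \<in> signed_perms (m + 1) \<longleftrightarrow> w \<in> signed_perms m"
proof -
  let ?A = "(\<lambda>a. \<bar>lift_above q a\<bar>) ` set w"
  have "set (insert_letter p q e w) = insert (e * (int q + 1)) (lift_above q ` set w)"
    unfolding insert_letter_def set_append list.set
    by (metis Un_insert_right append_take_drop_id set_append set_map)
  then have "abs ` set (insert_letter p q e w) = insert (int q + 1) ?A"
    using assms by (simp add: image_image abs_mult)
  moreover have "int q + 1 \<notin> ?A" by (auto simp: abs_lift_above split: if_splits)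
  moreover have "int q + 1 \<in> {1..int m + 1}" using assms by simp
  ultimately have "abs ` set (insert_letter p q e w) = {1..int m + 1} \<longleftrightarrow>
      ?A = {1..int m + 1} - {int q + 1}"
    by (metis Diff_insert_absorb insert_Diff)
  then show ?thesis
    using abs_lift_above_image[OF assms(1), of "set w"] by (simp add: signed_perms_iff add.commute)
qed

text \<open>The gap \<open>p\<close> is common to both sides. The letter behind it reveals
  \<open>e\<close> and \<open>q\<close>, and injectivity of \<open>lift_above q\<close> then
  recovers the word.\<close>

lemma insert_letter_inject:
  assumes eq: "insert_letter p q e w = insert_letter p q' e' w'"
    and "\<bar>e\<bar> = 1" "\<bar>e'\<bar> = 1" "p \<le> length w"
  shows "q = q' \<and> e = e' \<and> w = w'"
proof -
  have len: "length w = length w'" using eq by (metis add_right_cancel length_insert_letter)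
  have *: "take p (map (lift_above q) w) = take p (map (lift_above q') w')"
    "e * (int q + 1) = e' * (int q' + 1)"
    "drop p (map (lift_above q) w) = drop p (map (lift_above q') w')"
    using eq assms(4) len unfolding insert_letter_def by (auto simp: append_eq_append_conv)
  have "\<bar>e * (int q + 1)\<bar> = \<bar>e' * (int q' + 1)\<bar>" using *(2) by simp
  then have q: "q = q'" using assms by (simp add: abs_mult)
  moreover have "e = e'" using *(2) q by simp
  moreover have "map (lift_above q) w = map (lift_above q) w'"
    using *(1,3) q by (metis append_take_drop_id)
  then have "w = w'" using inj_lift_above by (simp add: inj_map_eq_map)
  ultimately show ?thesis by simp
qed

lemma lift_above_surj:
  assumes "\<bar>a\<bar> \<noteq> int q + 1"
  obtains b where "lift_above q b = a"
proof
  show "lift_above q (if \<bar>a\<bar> \<le> int q then a else a - sgn a) = a"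
    using assms by (auto simp: lift_above_def sgn_if)
qed

text \<open>Any letter can be taken for the inserted one: deleting the letter at position
  \<open>p + 1\<close> and closing the gap in the absolute values undoes an insertion.\<close>

lemma insert_letter_surj:
  assumes v: "v \<in> signed_perms (m + 1)" and p: "p \<le> m"
  obtains q e w where "q \<le> m" "\<bar>e\<bar> = 1" "w \<in> signed_perms m" "v = insert_letter p q e w"
proof -
  have len: "length v = m + 1" and set: "abs ` set v = {1..int m + 1}"
    using v by (simp_all add: signed_perms_iff add.commute)
  define x where "x = v ! p"
  have v_eq: "v = take p v @ x # drop (p + 1) v"
    using id_take_nth_drop[of p v] len p by (simp add: x_def)
  have "distinct (map abs v)" using len set by (intro card_distinct) simp
  then have fresh: "\<bar>x\<bar> \<notin> abs ` set (take p v @ drop (p + 1) v)"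
    by (subst (asm) v_eq) auto
  have "\<bar>x\<bar> \<in> {1..int m + 1}" using len p by (simp add: x_def flip: set)
  then have q: "nat \<bar>x\<bar> - 1 \<le> m" "\<bar>x\<bar> = int (nat \<bar>x\<bar> - 1) + 1" "\<bar>sgn x\<bar> = 1"
    by (auto simp: sgn_if)
  let ?q = "nat \<bar>x\<bar> - 1"
  \<comment> \<open>No other letter shares the absolute value of \<open>x\<close>, so all of them
    lie in the range of \<open>lift_above\<close>.\<close>
  have "\<forall>a\<in>set (take p v @ drop (p + 1) v). \<exists>b. lift_above ?q b = a"
    using fresh q(2) by (metis image_eqI lift_above_surj)
  then obtain w where w: "map (lift_above ?q) w = take p v @ drop (p + 1) v"
    by (metis ex_map_conv)
  have "sgn x * (int ?q + 1) = x" using q(2) by (metis mult.commute mult_sgn_abs)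
  then have ins: "insert_letter p ?q (sgn x) w = v"
    unfolding insert_letter_def w using len p v_eq by simp
  show thesis
    using that[of ?q "sgn x" w] q ins insert_letter_in_signed_perms_iff[OF q(1,3), of p w] v by simp
qed

section \<open>Effect of an insertion on descents\<close>

lemma sum_descent: "(\<Sum>i<length v. descent v i) = int (des_B v)"
proof -
  have "{i \<in> {..<length v}. i < length v \<and> letter v (i + 1) <r letter v i} =
      {i \<in> {0..<length v}. letter v (i + 1) <r letter v i}" by auto
  then show ?thesis by (simp add: des_B_def descent_def sum.If_cases of_bool_def Int_def)
qed

lemma descent_length [simp]: "descent w (length w) = 0"
  by (simp add: descent_def)

lemma below_length [simp]: "below q e w (length w + 1) = 0" "below q e w (Suc (length w)) = 0"
  by (simp_all add: below_def)

lemma r_less_linear: "a <r b \<or> a = b \<or> b <r a"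
  by (auto simp: r_less_def)

lemma r_less_trans: "a <r b \<Longrightarrow> b <r c \<Longrightarrow> a <r c"
  by (auto simp: r_less_def split: if_splits)

lemma r_less_asym: "a <r b \<Longrightarrow> \<not> b <r a"
  by (auto simp: r_less_def split: if_splits)

lemma lift_above_neq:
  assumes "\<bar>e\<bar> = 1"
  shows "lift_above q a \<noteq> e * (int q + 1)"
proof
  assume "lift_above q a = e * (int q + 1)"
  then have "\<bar>lift_above q a\<bar> = int q + 1" using assms by (simp add: abs_mult)
  then show False by (simp add: abs_lift_above split: if_splits)
qed

text \<open>Transitivity of \<open><r\<close> excludes the values 2 and -1: at a descent, if the
  first letter is below the new one, so is the second; at a non-descent, if the second is below, so
  is the first.\<close>

lemma keeps_des_cases:
  assumes "\<bar>e\<bar> = 1"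
  shows "keeps_des w p q e = 0 \<or> keeps_des w p q e = 1"
proof (cases "p < length w")
  case True
  let ?x = "e * (int q + 1)"
  let ?a = "lift_above q (letter w p)" and ?b = "lift_above q (letter w (p + 1))"
  have "?b <r ?a \<Longrightarrow> ?a <r ?x \<Longrightarrow> ?b <r ?x" by (rule r_less_trans)
  moreover have "\<not> ?b <r ?a \<Longrightarrow> ?b <r ?x \<Longrightarrow> ?a <r ?x"
    using r_less_linear[of ?a ?b] r_less_trans by auto
  ultimately show ?thesis using True
    by (auto simp: keeps_des_def descent_def below_def lift_above_r_less_iff)
qed (auto simp: keeps_des_def descent_def below_def)

text \<open>The comparison across the gap is replaced by two comparisons with the new letter, so
  \<open>descent w p\<close> gives way to \<open>1 - below q e w p\<close> and
  \<open>below q e w (p + 1)\<close>. All other comparisons are between lifted letters and do not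
  change.\<close>

lemma des_B_insert_letter:
  assumes p: "p \<le> length w" and e: "\<bar>e\<bar> = 1"
  shows "int (des_B (insert_letter p q e w)) = int (des_B w) + 1 - keeps_des w p q e"
proof -
  let ?u = "insert_letter p q e w" and ?m = "length w" and ?x = "e * (int q + 1)"
  have lo: "descent ?u i = descent w i" if "i < p" for i
    using that p by (simp add: descent_def letter_insert_letter lift_above_r_less_iff)
  have hi: "descent ?u (Suc i) = descent w i" if "p < i" "i < ?m" for i
    using that p by (simp add: descent_def letter_insert_letter lift_above_r_less_iff)
  have flip: "a <r ?x \<longleftrightarrow> \<not> ?x <r a" if "a = lift_above q b" for a b
    using that lift_above_neq[OF e] r_less_linear r_less_asym by metis
  have at_p: "descent ?u p = 1 - below q e w p"
    using p by (simp add: descent_def below_def letter_insert_letter flip)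
  show ?thesis
  proof (cases "p = ?m")
    case True
    have "int (des_B ?u) = (\<Sum>i<p. descent ?u i) + descent ?u p"
      using True sum_descent[of ?u] by simp
    also have "\<dots> = int (des_B w) + 1 - below q e w p"
      using lo at_p True sum_descent[of w] by simp
    finally show ?thesis using True by (simp add: keeps_des_def)
  next
    case False
    then have pm: "p < ?m" using p by simp
    have at_Suc: "descent ?u (Suc p) = below q e w (p + 1)"
      using pm by (simp add: descent_def below_def letter_insert_letter)
    have split: "(\<Sum>i<n. f i) = (\<Sum>i<p. f i) + f p + (\<Sum>i\<in>{Suc p..<n}. f i)"
      if "p < n" for n and f :: "nat \<Rightarrow> int"
    proof -
      have "(\<Sum>i<n. f i) = (\<Sum>i<p. f i) + (\<Sum>i\<in>{p..<n}. f i)"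
        using that by (simp add: lessThan_atLeast0 sum.atLeastLessThan_concat)
      then show ?thesis using that by (simp add: sum.atLeast_Suc_lessThan)
    qed
    have "(\<Sum>i\<in>{Suc p..<?m + 1}. descent ?u i) = descent ?u (Suc p) + (\<Sum>i\<in>{Suc (Suc p)..<Suc ?m}. descent ?u i)"
      using pm by (subst sum.atLeast_Suc_lessThan) simp_all
    also have "(\<Sum>i\<in>{Suc (Suc p)..<Suc ?m}. descent ?u i) = (\<Sum>i\<in>{Suc p..<?m}. descent w i)"
      unfolding sum.shift_bounds_Suc_ivl by (intro sum.cong) (auto simp: hi)
    finally show ?thesis
      using split[of "?m + 1" "descent ?u"] split[of ?m "descent w"] pm lo at_p at_Suc
        sum_descent[of ?u] sum_descent[of w]
      by (simp add: keeps_des_def)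
  qed
qed

section \<open>Inverse of an insertion\<close>

lemma letter_abs:
  assumes "w \<in> signed_perms m" "i \<in> {1..m}"
  shows "nat \<bar>letter w i\<bar> \<in> {1..m}" "\<bar>letter w i\<bar> \<le> int m" "letter w i \<noteq> 0"
proof -
  show *: "nat \<bar>letter w i\<bar> \<in> {1..m}"
    using assms by (auto simp: signed_perms_def bij_betw_def)
  then show "\<bar>letter w i\<bar> \<le> int m" "letter w i \<noteq> 0" by auto
qed

lemma sp_inv_eqI:
  assumes "w \<in> signed_perms n" "v \<in> signed_perms n"
    and "\<And>i. i \<in> {1..n} \<Longrightarrow> letter v (nat \<bar>letter w i\<bar>) = sgn (letter w i) * int i"
  shows "sp_inv w = v"
  using sp_inv_ex1[OF assms(1)] sp_inv_in_signed_perms[OF assms(1)] letter_sp_inv[OF assms(1)] assms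
  by blast

text \<open>In terms of signed permutation matrices, an insertion adds a row and a column that meet
  in an entry \<open>e\<close>; inversion is transposition and exchanges their indices.\<close>

lemma sp_inv_insert_letter:
  assumes w: "w \<in> signed_perms m" and pq: "p \<le> m" "q \<le> m" and e: "\<bar>e\<bar> = 1"
  shows "sp_inv (insert_letter p q e w) = insert_letter q p e (sp_inv w)"
proof (rule sp_inv_eqI)
  let ?v = "sp_inv w"
  have v: "?v \<in> signed_perms m" using w by (rule sp_inv_in_signed_perms)
  have len: "length w = m" "length ?v = m" using w v by (simp_all add: signed_perms_def)
  show "insert_letter p q e w \<in> signed_perms (m + 1)" "insert_letter q p e ?v \<in> signed_perms (m + 1)"
    using w v pq e by (simp_all only: insert_letter_in_signed_perms_iff)
  have old: "letter (insert_letter q p e ?v) (nat \<bar>lift_above q (letter w j)\<bar>) =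
      sgn (letter w j) * (if j \<le> p then int j else int j + 1)" if j: "j \<in> {1..m}" for j
  proof -
    have a: "letter ?v (nat \<bar>letter w j\<bar>) = sgn (letter w j) * int j"
      using w j by (rule letter_sp_inv)
    \<comment> \<open>Lifting at \<open>p\<close> acts on the values of the inverse exactly as the
      insertion acts on the positions of \<open>w\<close>.\<close>
    have l: "lift_above p (sgn (letter w j) * int j) =
        sgn (letter w j) * (if j \<le> p then int j else int j + 1)"
      using j letter_abs(3)[OF w j] by (auto simp: lift_above_def sgn_if)
    show ?thesis
    proof (cases "\<bar>letter w j\<bar> \<le> int q")
      case True
      then have "nat \<bar>letter w j\<bar> \<le> q" by simp
      then show ?thesis using True a l pq len
        by (simp add: letter_insert_letter abs_lift_above)
    next
      case False
      then have "nat (\<bar>letter w j\<bar> + 1) = nat \<bar>letter w j\<bar> + 1" "nat \<bar>letter w j\<bar> > q" by auto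
      moreover have "nat \<bar>letter w j\<bar> \<le> m" using letter_abs(1)[OF w j] by simp
      ultimately show ?thesis using a l pq len False
        by (simp add: letter_insert_letter abs_lift_above)
    qed
  qed
  fix i assume i: "i \<in> {1..m + 1}"
  have new: "nat \<bar>e * (int q + 1)\<bar> = q + 1" using e by (simp add: abs_mult nat_add_distrib)
  have sgn: "sgn (e * (int q + 1)) = e" using e by (auto simp: sgn_if abs_if split: if_splits)
  consider "i \<le> p" | "i = p + 1" | "i > p + 1" by linarith
  then show "letter (insert_letter q p e ?v) (nat \<bar>letter (insert_letter p q e w) i\<bar>) =
      sgn (letter (insert_letter p q e w) i) * int i"
  proof cases
    case 1
    then show ?thesis using i pq len old[of i] by (simp add: letter_insert_letter[of p w i])
  next
    case 2
    then have "letter (insert_letter p q e w) i = e * (int q + 1)"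
      using pq len by (simp add: letter_insert_letter)
    then show ?thesis using 2 pq len new sgn by (simp add: letter_insert_letter)
  next
    case 3
    then obtain j where j: "i = Suc j" "p < j" by (cases i) auto
    then show ?thesis using i pq len old[of j] by (simp add: letter_insert_letter[of p w "Suc j"] add.commute)
  qed
qed

lemma letter_sp_inv_eq_iff:
  assumes w: "w \<in> signed_perms m" and pq: "p \<in> {1..m}" "q \<in> {1..m}" and e: "\<bar>e\<bar> = 1"
  shows "letter (sp_inv w) q = e * int p \<longleftrightarrow> letter w p = e * int q"
proof
  assume "letter w p = e * int q"
  then show "letter (sp_inv w) q = e * int p"
    using letter_sp_inv[OF w pq(1)] pq e by (auto simp: abs_mult sgn_mult sgn_if abs_if split: if_splits)
next
  assume eq: "letter (sp_inv w) q = e * int p"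
  obtain i where i: "i \<in> {1..m}" "q = nat \<bar>letter w i\<bar>"
  proof -
    have "q \<in> (\<lambda>i. nat \<bar>letter w i\<bar>) ` {1..m}"
      using w pq(2) by (simp add: signed_perms_def bij_betw_def)
    then show thesis using that by blast
  qed
  have *: "sgn (letter w i) * int i = e * int p" using letter_sp_inv[OF w i(1)] eq i(2) by simp
  have "\<bar>sgn (letter w i) * int i\<bar> = \<bar>e * int p\<bar>" using * by simp
  then have "i = p" using e letter_abs(3)[OF w i(1)] by (simp add: abs_mult)
  moreover have "sgn (letter w i) = e" using * \<open>i = p\<close> pq by simp
  ultimately show "letter w p = e * int q" using i(2) sgn_mult_abs[of "letter w i"] by simp
qed

section \<open>Sums over gaps and values for one sign\<close>

text \<open>The convention \<open>letter w 0 = 0\<close> separates the two signs; this boundary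
  value is the source of the terms \<open>of_bool (e = 1)\<close> in the sums that follow.\<close>

lemma below_0 [simp]: "\<bar>e\<bar> = 1 \<Longrightarrow> below q e w 0 = of_bool (e = 1)"
  by (auto simp: below_def lift_above_def r_less_def abs_if split: if_splits)

text \<open>Raising \<open>q\<close> by one moves the new letter up in \<open><r\<close> past a
  single old letter value, \<open>e * int (Suc q)\<close>. The reversal of the negatives in
  \<open><r\<close> makes the direction the same for both signs.\<close>

lemma below_Suc_diff:
  assumes "\<bar>e\<bar> = 1"
  shows "below (Suc q) e w p - below q e w p = of_bool (p \<le> length w \<and> letter w p = e * int (Suc q))"
proof -
  have "lift_above (Suc q) a <r e * (int (Suc q) + 1) \<longleftrightarrow>
      lift_above q a <r e * (int q + 1) \<or> a = e * int (Suc q)" for a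
  proof (cases "e = 1")
    case True
    then show ?thesis by (simp add: lift_above_def r_less_def sgn_if)
  next
    case False
    then have "e = -1" using assms by linarith
    then show ?thesis by (simp add: lift_above_def r_less_def sgn_if)
  qed
  moreover have "\<not> lift_above q (e * int (Suc q)) <r e * (int q + 1)"
  proof (cases "e = 1")
    case True
    then show ?thesis by (simp add: lift_above_def r_less_def)
  next
    case False
    then have "e = -1" using assms by linarith
    then show ?thesis by (simp add: lift_above_def r_less_def)
  qed
  ultimately show ?thesis by (auto simp: below_def)
qed

lemma sum_below_telescope:
  assumes "\<bar>e\<bar> = 1"
  shows "(\<Sum>p\<le>length w. below q e w p - below q e w (p + 1)) = of_bool (e = 1)"
  using sum_telescope[of "below q e w" "length w"] assms by simp

lemma sum_keeps_des:
  assumes "\<bar>e\<bar> = 1"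
  shows "(\<Sum>p\<le>length w. keeps_des w p q e) = int (des_B w) + of_bool (e = 1)"
proof -
  have "(\<Sum>p\<le>length w. keeps_des w p q e) =
      (\<Sum>p\<le>length w. descent w p) + (\<Sum>p\<le>length w. below q e w p - below q e w (p + 1))"
    by (simp add: keeps_des_def sum.distrib sum_subtractf)
  also have "(\<Sum>p\<le>length w. descent w p) = int (des_B w)"
    by (simp add: sum_descent flip: lessThan_Suc_atMost)
  finally show ?thesis using sum_below_telescope[OF assms] by simp
qed

text \<open>Abel summation, arranged so that \<open>W\<close> is evaluated up to \<open>m\<close>
  only; the boundary value \<open>h (Suc m)\<close> vanishes when \<open>h\<close> is
  \<open>below q e w\<close> with \<open>length w = m\<close>.\<close>

lemma sum_by_parts:
  fixes h W :: "nat \<Rightarrow> 'a :: comm_ring_1"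
  shows "(\<Sum>p\<le>m. (h p - h (Suc p)) * W p) =
    h 0 * W 0 - h (Suc m) * W m + (\<Sum>p<m. h (Suc p) * (W (Suc p) - W p))"
proof (induction m)
  case (Suc m)
  then show ?case by (simp add: algebra_simps)
qed (simp add: algebra_simps)

text \<open>
  Differencing \<open>below p e (sp_inv w) q\<close> in \<open>p\<close> gives the indicator of the signed permutation matrix, which
  is also the difference of \<open>below q e w p\<close> in \<open>q\<close>. Summation by parts therefore turns the sum into a
  count of matrix entries with sign \<open>e\<close>, plus a boundary term.
\<close>

lemma sum_below_prod:
  assumes w: "w \<in> signed_perms m" and e: "\<bar>e\<bar> = 1"
  shows "(\<Sum>p\<le>m. \<Sum>q\<le>m. (below q e w p - below q e w (p + 1)) *
      (below p e (sp_inv w) q - below p e (sp_inv w) (q + 1))) =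
    of_bool (e = 1) + (\<Sum>p<m. of_bool (sgn (letter w (Suc p)) = e))"
proof -
  let ?v = "sp_inv w"
  define W where "W = (\<lambda>q p. below p e ?v q - below p e ?v (q + 1))"
  have v: "?v \<in> signed_perms m" using w by (rule sp_inv_in_signed_perms)
  have len: "length w = m" "length ?v = m" using w v by (simp_all add: signed_perms_def)
  have W_diff: "W q (Suc p) - W q p =
      of_bool (letter w (Suc p) = e * int q) - of_bool (letter w (Suc p) = e * int (Suc q))"
    if p: "p < m" and q: "q \<le> m" for p q
  proof -
    \<comment> \<open>The guard \<open>r \<le> m\<close> comes from \<open>below\<close>. In the
      extreme cases \<open>r = 0\<close> and \<open>r = Suc m\<close> both sides are false, because
      the letters of \<open>w\<close> have absolute values from 1 to \<open>m\<close>.\<close>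
    have iff: "r \<le> m \<and> letter ?v r = e * int (Suc p) \<longleftrightarrow> letter w (Suc p) = e * int r"
      if "r \<le> Suc m" for r
    proof -
      have nz: "letter w (Suc p) \<noteq> 0" and le: "\<bar>letter w (Suc p)\<bar> \<le> int m"
        using letter_abs[OF w, of "Suc p"] p by auto
      consider "r = 0" | "r \<in> {1..m}" | "r = Suc m" using \<open>r \<le> Suc m\<close> by force
      then show ?thesis
      proof cases
        case 1
        then show ?thesis using nz e by auto
      next
        case 2
        then show ?thesis using letter_sp_inv_eq_iff[OF w _ 2 e, of "Suc p"] p by auto
      next
        case 3
        then have "\<bar>letter w (Suc p)\<bar> \<noteq> \<bar>e * int r\<bar>" using le e by (simp add: abs_mult)
        then show ?thesis using 3 by auto
      qed
    qed
    have "W q (Suc p) - W q p = (below (Suc p) e ?v q - below p e ?v q) -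
        (below (Suc p) e ?v (q + 1) - below p e ?v (q + 1))"
      by (simp add: W_def)
    also have "\<dots> = of_bool (q \<le> m \<and> letter ?v q = e * int (Suc p)) -
        of_bool (Suc q \<le> m \<and> letter ?v (Suc q) = e * int (Suc p))"
      by (simp only: below_Suc_diff[OF e] len flip: Suc_eq_plus1)
    finally show ?thesis using iff[of q] iff[of "Suc q"] q by simp
  qed
  \<comment> \<open>If the letter is \<open>e * int (Suc b)\<close>, the two indicators single out
    \<open>q = Suc b\<close> and \<open>q = b\<close>. The sum is then the increment of
    \<open>below\<close> from \<open>b\<close> to \<open>Suc b\<close>, which is 1 because the new
    letter passes this very letter. With the other sign both indicators vanish.\<close>
  have row: "(\<Sum>q\<le>m. below q e w (Suc p) * (W q (Suc p) - W q p)) =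
      of_bool (sgn (letter w (Suc p)) = e)" if p: "p < m" for p
  proof -
    let ?h = "\<lambda>q. below q e w (Suc p)" and ?a = "letter w (Suc p)"
    have nz: "?a \<noteq> 0" and le: "\<bar>?a\<bar> \<le> int m" using letter_abs[OF w, of "Suc p"] p by auto
    have "(\<Sum>q\<le>m. ?h q * (W q (Suc p) - W q p)) =
        (\<Sum>q\<le>m. ?h q * (of_bool (?a = e * int q) - of_bool (?a = e * int (Suc q))))"
      using p W_diff by (intro sum.cong) auto
    also have "\<dots> = of_bool (sgn ?a = e)"
    proof (cases "sgn ?a = e")
      case True
      define b where "b = nat \<bar>?a\<bar> - 1"
      have b: "?a = e * int (Suc b)" "b < m"
        using True nz le by (auto simp: b_def sgn_if)
      have iff: "?a = e * int r \<longleftrightarrow> r = Suc b" for r using b(1) e by auto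
      have "(\<Sum>q\<le>m. ?h q * (of_bool (?a = e * int q) - of_bool (?a = e * int (Suc q)))) =
          (\<Sum>q\<le>m. (if q = Suc b then ?h q else 0) - (if q = b then ?h q else 0))"
        by (intro sum.cong refl) (simp only: iff nat.inject of_bool_def, simp)
      also have "\<dots> = ?h (Suc b) - ?h b" using b(2) by (simp add: sum_subtractf)
      also have "\<dots> = 1" using b len p by (simp add: below_Suc_diff[OF e])
      finally show ?thesis using True by simp
    next
      case False
      have "?a \<noteq> e * int r" for r
        using False nz e by (cases "r = 0") (auto simp: sgn_if abs_if split: if_splits)
      then show ?thesis using False by (simp del: of_nat_Suc)
    qed
    finally show ?thesis .
  qed
  have "(\<Sum>p\<le>m. \<Sum>q\<le>m. (below q e w p - below q e w (p + 1)) * W q p) =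
      (\<Sum>q\<le>m. \<Sum>p\<le>m. (below q e w p - below q e w (Suc p)) * W q p)"
    by (subst sum.swap) simp
  \<comment> \<open>Summation by parts runs over \<open>p\<close> with \<open>q\<close> fixed; the
    boundary term at \<open>p = m\<close> disappears because \<open>below\<close> vanishes at
    \<open>m + 1\<close>.\<close>
  also have "\<dots> = (\<Sum>q\<le>m. of_bool (e = 1) * W q 0 +
      (\<Sum>p<m. below q e w (Suc p) * (W q (Suc p) - W q p)))"
    unfolding sum_by_parts using e below_length(2)[where w = w] len by simp
  also have "\<dots> = of_bool (e = 1) * (\<Sum>q\<le>m. W q 0) +
      (\<Sum>p<m. \<Sum>q\<le>m. below q e w (Suc p) * (W q (Suc p) - W q p))"
    unfolding sum.distrib sum_distrib_left by (subst (2) sum.swap) simp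
  also have "(\<Sum>q\<le>m. W q 0) = of_bool (e = 1)"
    using sum_below_telescope[OF e, where w = ?v] len by (simp add: W_def)
  finally show ?thesis using row by (simp add: W_def)
qed

section \<open>Sums over all insertions into a fixed word\<close>

definition insertions :: "nat \<Rightarrow> (int \<times> nat \<times> nat) set" where
  "insertions m = {1, -1} \<times> {..m} \<times> {..m}"

lemma sum_insertions:
  "(\<Sum>(e, p, q)\<in>insertions m. f e p q) = (\<Sum>e\<in>{1, -1}. \<Sum>p\<le>m. \<Sum>q\<le>m. f e p q)"
  by (simp only: insertions_def sum.cartesian_product split_def fst_conv snd_conv)

lemma insertions_abs: "(e, p, q) \<in> insertions m \<Longrightarrow> \<bar>e\<bar> = 1 \<and> p \<le> m \<and> q \<le> m"
  by (auto simp: insertions_def)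

text \<open>The second form is meant for the inverse, where gap and value have exchanged roles. In
  both, the gap sum is \<open>des_B w + 1\<close> for \<open>e = 1\<close> and
  \<open>des_B w\<close> for \<open>e = -1\<close>, and the free value index contributes the factor
  \<open>m + 1\<close>.\<close>

lemma sum_insertions_keeps_des:
  assumes "length w = m"
  shows "(\<Sum>(e, p, q)\<in>insertions m. keeps_des w p q e) = (int m + 1) * (2 * int (des_B w) + 1)"
    and "(\<Sum>(e, p, q)\<in>insertions m. keeps_des w q p e) = (int m + 1) * (2 * int (des_B w) + 1)"
proof -
  have *: "(\<Sum>p\<le>m. keeps_des w p q e) = int (des_B w) + of_bool (e = 1)" if "\<bar>e\<bar> = 1" for q e
    using sum_keeps_des[OF that, of w q] assms by simp
  show "(\<Sum>(e, p, q)\<in>insertions m. keeps_des w q p e) = (int m + 1) * (2 * int (des_B w) + 1)"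
    by (simp add: sum_insertions * algebra_simps)
  have "(\<Sum>p\<le>m. \<Sum>q\<le>m. keeps_des w p q e) = (\<Sum>q\<le>m. \<Sum>p\<le>m. keeps_des w p q e)" for e
    by (rule sum.swap)
  then show "(\<Sum>(e, p, q)\<in>insertions m. keeps_des w p q e) = (int m + 1) * (2 * int (des_B w) + 1)"
    by (simp add: sum_insertions * algebra_simps)
qed

text \<open>Each indicator is a descent term plus a telescoping difference. Of the four products,
  three have sums that factor, and \<open>sum_below_prod\<close> evaluates the product of the two
  differences.\<close>

lemma sum_insertions_keeps_both:
  assumes w: "w \<in> signed_perms m"
  shows "(\<Sum>(e, p, q)\<in>insertions m. keeps_des w p q e * keeps_des (sp_inv w) q p e) =
    int m + 1 + int (des_B w) + int (ides_B w) + 2 * int (des_B w) * int (ides_B w)"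
proof -
  let ?v = "sp_inv w" and ?a = "int (des_B w)" and ?b = "int (ides_B w)"
  have v: "?v \<in> signed_perms m" using w by (rule sp_inv_in_signed_perms)
  have len: "length w = m" "length ?v = m" using w v by (simp_all add: signed_perms_def)
  have d: "(\<Sum>p\<le>m. descent w p) = ?a" and c: "(\<Sum>q\<le>m. descent ?v q) = ?b"
    using sum_descent[of w] sum_descent[of ?v] len
    by (simp_all add: ides_B_def flip: lessThan_Suc_atMost)
      (metis add.right_neutral descent_length)+
  have one: "(\<Sum>p\<le>m. \<Sum>q\<le>m. keeps_des w p q e * keeps_des ?v q p e) =
      ?a * ?b + (?a + ?b + 1) * of_bool (e = 1) + (\<Sum>p<m. of_bool (sgn (letter w (Suc p)) = e))"
    if e: "\<bar>e\<bar> = 1" for e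
  proof -
    define A where "A = (\<lambda>p q. below q e w p - below q e w (p + 1))"
    define B where "B = (\<lambda>p q. below p e ?v q - below p e ?v (q + 1))"
    have A: "(\<Sum>p\<le>m. A p q) = of_bool (e = 1)" for q
      using sum_below_telescope[OF e, where w = w] len by (simp add: A_def)
    have B: "(\<Sum>q\<le>m. B p q) = of_bool (e = 1)" for p
      using sum_below_telescope[OF e, where w = ?v] len by (simp add: B_def)
    have "(\<Sum>p\<le>m. \<Sum>q\<le>m. keeps_des w p q e * keeps_des ?v q p e) =
        (\<Sum>p\<le>m. \<Sum>q\<le>m. descent w p * descent ?v q + descent w p * B p q
          + descent ?v q * A p q + A p q * B p q)"
      by (simp add: keeps_des_def A_def B_def algebra_simps)
    also have "\<dots> = (\<Sum>p\<le>m. \<Sum>q\<le>m. descent w p * descent ?v q)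
        + (\<Sum>p\<le>m. \<Sum>q\<le>m. descent w p * B p q)
        + (\<Sum>p\<le>m. \<Sum>q\<le>m. descent ?v q * A p q) + (\<Sum>p\<le>m. \<Sum>q\<le>m. A p q * B p q)"
      by (simp only: sum.distrib)
    also have "(\<Sum>p\<le>m. \<Sum>q\<le>m. descent w p * descent ?v q) = ?a * ?b"
      by (simp only: d c flip: sum_product)
    also have "(\<Sum>p\<le>m. \<Sum>q\<le>m. descent w p * B p q) = ?a * of_bool (e = 1)"
      by (simp only: B d flip: sum_distrib_left sum_distrib_right)
    also have "(\<Sum>p\<le>m. \<Sum>q\<le>m. descent ?v q * A p q) = ?b * of_bool (e = 1)"
      by (subst sum.swap) (simp only: A c flip: sum_distrib_left sum_distrib_right)
    also have "(\<Sum>p\<le>m. \<Sum>q\<le>m. A p q * B p q) =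
        of_bool (e = 1) + (\<Sum>p<m. of_bool (sgn (letter w (Suc p)) = e))"
      using sum_below_prod[OF w e] by (simp add: A_def B_def)
    finally show ?thesis by (simp add: algebra_simps)
  qed
  \<comment> \<open>Each letter has exactly one sign, so the two sign counts add up to
    \<open>m\<close>.\<close>
  have "(\<Sum>p<m. of_bool (sgn (letter w (Suc p)) = 1) + of_bool (sgn (letter w (Suc p)) = -1)) =
      (\<Sum>p<m. 1 :: int)"
    using letter_abs(3)[OF w] by (intro sum.cong) (auto simp: sgn_if)
  then show ?thesis by (simp add: sum_insertions one sum.distrib)
qed

section \<open>Double counting and the recurrence\<close>

lemma finite_signed_perms [simp]: "finite (signed_perms n)"
proof (rule finite_subset)
  show "signed_perms n \<subseteq> {w. set w \<subseteq> {- int n..int n} \<and> length w = n}"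
  proof
    fix w assume w: "w \<in> signed_perms n"
    have "a \<in> {- int n..int n}" if "a \<in> set w" for a
    proof -
      have "\<bar>a\<bar> \<in> abs ` set w" using that by simp
      then show ?thesis using w by (auto simp: signed_perms_iff)
    qed
    then show "w \<in> {w. set w \<subseteq> {- int n..int n} \<and> length w = n}"
      using w by (auto simp: signed_perms_iff)
  qed
qed (simp add: finite_lists_length_eq)

text \<open>Integer indices let \<open>i - 1\<close> and \<open>j - 1\<close> become negative, where
  the indicator is 0; the boundary cases then need no separate treatment.\<close>

definition has_des :: "int \<Rightarrow> int \<Rightarrow> int list \<Rightarrow> int" where
  "has_des i j w = of_bool (int (des_B w) = i \<and> int (ides_B w) = j)"

lemma b_num_eq_sum: "int (b_num n i j) = (\<Sum>w\<in>signed_perms n. has_des i j w)"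
  by (simp add: b_num_def has_des_def sum_of_bool_eq Int_def)

text \<open>The target consists of words with a marked position, the marked letter being the
  inserted one. Each word occurs \<open>m + 1\<close> times, which is the factor on the left of the
  recurrence.\<close>

lemma bij_betw_insert_letter:
  "bij_betw (\<lambda>(w, e, p, q). (insert_letter p q e w, p))
     (signed_perms m \<times> insertions m) (signed_perms (m + 1) \<times> {..m})"
proof (rule bij_betw_imageI)
  show "inj_on (\<lambda>(w, e, p, q). (insert_letter p q e w, p)) (signed_perms m \<times> insertions m)"
    by (intro inj_onI) (auto simp: signed_perms_iff dest!: insertions_abs insert_letter_inject)
  show "(\<lambda>(w, e, p, q). (insert_letter p q e w, p)) ` (signed_perms m \<times> insertions m) =
      signed_perms (m + 1) \<times> {..m}"
  proof (intro equalityI subsetI)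
    fix x assume "x \<in> signed_perms (m + 1) \<times> {..m}"
    then obtain v p where x: "x = (v, p)" and v: "v \<in> signed_perms (m + 1)" "p \<le> m" by auto
    obtain q e w where "q \<le> m" "\<bar>e\<bar> = 1" "w \<in> signed_perms m" "v = insert_letter p q e w"
      using insert_letter_surj[OF v] .
    moreover from this have "e = 1 \<or> e = -1" by linarith
    ultimately show "x \<in> (\<lambda>(w, e, p, q). (insert_letter p q e w, p)) ` (signed_perms m \<times> insertions m)"
      using x v by (intro image_eqI[of _ _ "(w, e, p, q)"]) (auto simp: insertions_def)
  qed (auto dest!: insertions_abs simp del: Suc_eq_plus1 add_Suc_right simp: insert_letter_in_signed_perms_iff[simplified])
qed

text \<open>\<open>D\<close> and \<open>E\<close> are 0 or 1, so exactly one of the four products is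
  1. The polynomial form allows summation over all insertions.\<close>

lemma has_des_insert_letter:
  assumes w: "w \<in> signed_perms m" and "(e, p, q) \<in> insertions m"
  defines "D \<equiv> keeps_des w p q e" and "E \<equiv> keeps_des (sp_inv w) q p e"
  shows "has_des i j (insert_letter p q e w) =
    D * E * has_des i j w + D * (1 - E) * has_des i (j - 1) w
    + (1 - D) * E * has_des (i - 1) j w + (1 - D) * (1 - E) * has_des (i - 1) (j - 1) w"
proof -
  have e: "\<bar>e\<bar> = 1" and pq: "p \<le> m" "q \<le> m" using assms(2) insertions_abs by blast+
  have len: "length w = m" "length (sp_inv w) = m"
    using w sp_inv_in_signed_perms[OF w] by (simp_all add: signed_perms_def)
  have "int (des_B (insert_letter p q e w)) = int (des_B w) + 1 - D"
    unfolding D_def using pq len e by (intro des_B_insert_letter) auto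
  moreover have "int (ides_B (insert_letter p q e w)) = int (ides_B w) + 1 - E"
    unfolding E_def ides_B_def sp_inv_insert_letter[OF w pq e]
    using pq len e by (intro des_B_insert_letter) auto
  moreover have "D = 0 \<or> D = 1" "E = 0 \<or> E = 1"
    unfolding D_def E_def using e by (rule keeps_des_cases)+
  ultimately show ?thesis by (auto simp: has_des_def)
qed

lemma sum_has_des_insertions:
  assumes w: "w \<in> signed_perms m"
  shows "(\<Sum>(e, p, q)\<in>insertions m. has_des i j (insert_letter p q e w)) =
    (int (m + 1) + i + j + 2 * i * j) * has_des i j w
    + ((2 * int (m + 1) - 1) * i - (2 * i + 1) * (j - 1)) * has_des i (j - 1) w
    + ((2 * int (m + 1) - 1) * j - (2 * j + 1) * (i - 1)) * has_des (i - 1) j w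
    + ((2 * (int (m + 1))^2 - int (m + 1)) + 2 * (i - 1) * (j - 1)
        + (1 - 2 * int (m + 1)) * (i + j - 2)) * has_des (i - 1) (j - 1) w"
proof -
  let ?D = "\<lambda>e p q. keeps_des w p q e" and ?E = "\<lambda>e p q. keeps_des (sp_inv w) q p e"
  let ?a = "int (des_B w)" and ?b = "int (ides_B w)" and ?n = "int m + 1"
  have len: "length w = m" "length (sp_inv w) = m"
    using w sp_inv_in_signed_perms[OF w] by (simp_all add: signed_perms_def)
  have one: "(\<Sum>(e, p, q)\<in>insertions m. 1 :: int) = 2 * ?n^2"
    by (simp add: insertions_def card_cartesian_product power2_eq_square algebra_simps)
  note D = sum_insertions_keeps_des(1)[OF len(1)] and E = sum_insertions_keeps_des(2)[OF len(2)]
    and DE = sum_insertions_keeps_both[OF w]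
  \<comment> \<open>Regrouped by the monomials \<open>D * E\<close>, \<open>D\<close>,
    \<open>E\<close> and 1, whose sums are known.\<close>
  have "(\<Sum>(e, p, q)\<in>insertions m. has_des i j (insert_letter p q e w)) =
     (\<Sum>(e, p, q)\<in>insertions m.
        ?D e p q * ?E e p q * (has_des i j w - has_des i (j - 1) w - has_des (i - 1) j w + has_des (i - 1) (j - 1) w)
        + ?D e p q * (has_des i (j - 1) w - has_des (i - 1) (j - 1) w)
        + ?E e p q * (has_des (i - 1) j w - has_des (i - 1) (j - 1) w)
        + 1 * has_des (i - 1) (j - 1) w)"
    by (intro sum.cong) (auto simp: has_des_insert_letter[OF w] algebra_simps)
  also have "\<dots> =
      (?n + ?a + ?b + 2 * ?a * ?b)
        * (has_des i j w - has_des i (j - 1) w - has_des (i - 1) j w + has_des (i - 1) (j - 1) w)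
      + ?n * (2 * ?a + 1) * (has_des i (j - 1) w - has_des (i - 1) (j - 1) w)
      + ?n * (2 * ?b + 1) * (has_des (i - 1) j w - has_des (i - 1) (j - 1) w)
      + 2 * ?n^2 * has_des (i - 1) (j - 1) w"
    using D E DE one unfolding split_def sum.distrib ides_B_def
    by (simp only: flip: sum_distrib_right)
  also have "\<dots> = (?n + ?a + ?b + 2 * ?a * ?b) * has_des i j w
      + (?n * (2 * ?a + 1) - (?n + ?a + ?b + 2 * ?a * ?b)) * has_des i (j - 1) w
      + (?n * (2 * ?b + 1) - (?n + ?a + ?b + 2 * ?a * ?b)) * has_des (i - 1) j w
      + (2 * ?n^2 - ?n * (2 * ?a + 1) - ?n * (2 * ?b + 1) + (?n + ?a + ?b + 2 * ?a * ?b))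
        * has_des (i - 1) (j - 1) w"
    by (simp add: algebra_simps)
  \<comment> \<open>A summand is nonzero only if the statistics of \<open>w\<close> equal the
    indices of its \<open>has_des\<close>, so these indices may replace them in the coefficient; for
    instance \<open>des_B w = i\<close> and \<open>ides_B w = j - 1\<close> in the second.\<close>
  also have "\<dots> = (int (m + 1) + i + j + 2 * i * j) * has_des i j w
    + ((2 * int (m + 1) - 1) * i - (2 * i + 1) * (j - 1)) * has_des i (j - 1) w
    + ((2 * int (m + 1) - 1) * j - (2 * j + 1) * (i - 1)) * has_des (i - 1) j w
    + ((2 * (int (m + 1))^2 - int (m + 1)) + 2 * (i - 1) * (j - 1)
        + (1 - 2 * int (m + 1)) * (i + j - 2)) * has_des (i - 1) (j - 1) w"
    unfolding has_des_def
    by (intro arg_cong2[where f = "(+)"]) (auto simp: of_bool_def power2_eq_square algebra_simps)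
  finally show ?thesis .
qed

lemma b_num_recurrence:
  "int (m + 1) * int (b_num (m + 1) i j) =
    (int (m + 1) + i + j + 2 * i * j) * int (b_num m i j)
    + ((2 * int (m + 1) - 1) * i - (2 * i + 1) * (j - 1)) * int (b_num m i (j - 1))
    + ((2 * int (m + 1) - 1) * j - (2 * j + 1) * (i - 1)) * int (b_num m (i - 1) j)
    + ((2 * (int (m + 1))^2 - int (m + 1)) + 2 * (i - 1) * (j - 1)
        + (1 - 2 * int (m + 1)) * (i + j - 2)) * int (b_num m (i - 1) (j - 1))"
proof -
  have "int (m + 1) * int (b_num (m + 1) i j) =
      (\<Sum>(v, p)\<in>signed_perms (m + 1) \<times> {..m}. has_des i j v)"
    by (simp add: b_num_eq_sum sum_distrib_left flip: sum.cartesian_product)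
  also have "\<dots> = (\<Sum>(w, e, p, q)\<in>signed_perms m \<times> insertions m. has_des i j (insert_letter p q e w))"
    by (subst sum.reindex_bij_betw[OF bij_betw_insert_letter, symmetric]) (simp add: split_def)
  also have "\<dots> = (\<Sum>w\<in>signed_perms m. \<Sum>(e, p, q)\<in>insertions m. has_des i j (insert_letter p q e w))"
    by (simp only: sum.cartesian_product split_def)
  finally show ?thesis
    by (simp only: sum_has_des_insertions cong: sum.cong)
      (simp only: b_num_eq_sum sum.distrib sum_distrib_left)
qed

text \<open>The empty word is the base case: \<open>b_num_recurrence\<close> with
  \<open>m = 0\<close> turns it into the four values for length 1.\<close>

lemma b_num_0: "b_num 0 i j = of_bool (i = 0 \<and> j = 0)"
proof -
  have perms: "signed_perms 0 = {[]}" by (auto simp: signed_perms_iff)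
  have "sp_inv [] = []" using sp_inv_in_signed_perms[of "[]" 0] by (simp add: perms)
  then have "des_B [] = 0" "ides_B [] = 0" by (simp_all add: des_B_def ides_B_def)
  then show ?thesis by (auto simp: b_num_def perms Collect_conv_if cong: conj_cong)
qed

theorem theorem1p3:
  shows "b_num 1 0 0 = 1 \<and> b_num 1 1 1 = 1 \<and> b_num 1 0 1 = 0 \<and> b_num 1 1 0 = 0 \<and>
    (\<forall>n :: nat. \<forall>i j :: int. n \<ge> 2 \<longrightarrow> 0 \<le> i \<longrightarrow> i \<le> int n \<longrightarrow> 0 \<le> j \<longrightarrow> j \<le> int n \<longrightarrow>
      int n * int (b_num n i j) =
        (int n + i + j + 2 * i * j) * int (b_num (n - 1) i j)
        + ((2 * int n - 1) * i - (2 * i + 1) * (j - 1)) * int (b_num (n - 1) i (j - 1))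
        + ((2 * int n - 1) * j - (2 * j + 1) * (i - 1)) * int (b_num (n - 1) (i - 1) j)
        + ((2 * (int n)^2 - int n) + 2 * (i - 1) * (j - 1) + (1 - 2 * int n) * (i + j - 2))
          * int (b_num (n - 1) (i - 1) (j - 1)))"
proof (intro conjI allI impI)
  show "b_num 1 0 0 = 1" "b_num 1 1 1 = 1" "b_num 1 0 1 = 0" "b_num 1 1 0 = 0"
    using b_num_recurrence[of 0 0 0] b_num_recurrence[of 0 1 1]
      b_num_recurrence[of 0 0 1] b_num_recurrence[of 0 1 0]
    by (simp_all add: b_num_0)
  fix n :: nat and i j :: int
  assume "n \<ge> 2"
  then have "n = n - 1 + 1" by simp
  then show "int n * int (b_num n i j) =
        (int n + i + j + 2 * i * j) * int (b_num (n - 1) i j)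
        + ((2 * int n - 1) * i - (2 * i + 1) * (j - 1)) * int (b_num (n - 1) i (j - 1))
        + ((2 * int n - 1) * j - (2 * j + 1) * (i - 1)) * int (b_num (n - 1) (i - 1) j)
        + ((2 * (int n)^2 - int n) + 2 * (i - 1) * (j - 1) + (1 - 2 * int n) * (i + j - 2))
          * int (b_num (n - 1) (i - 1) (j - 1))"
    using b_num_recurrence[of "n - 1" i j] by metis
qed

end
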